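(* Let $l$ be a complete lattice which is a de Morgan algebra with residual implication. Let $TS=(S,Act,\to,I,AP,L)$ be an mv-transition system without terminal states, and let $P:(2^{AP})^{\omega}\to l$ be such that $L_\omega(\mathcal A)=P$ for some deterministic $l$-valued Büchi automaton $\mathcal A=(Q,2^{AP},\delta,q_0,F)$. Then $TS\models P$ if and only if $TS\otimes\mathcal A\models\mathrm{dpers}(\varphi)$, where $\varphi=\bigvee_{q\in Q}(F(q)\wedge q)$ is an mv-proposition formula over the atomic propositions $Q$.
   Context: $l$: complete distributive lattice with $x\wedge\bigvee a_i=\bigvee(x\wedge a_i)$, order-reversing involution $\neg$, implication $a\to b=\bigvee\{c:a\wedge c\le b\}$. An mv-TS is $(S,Act,\to,I,AP,L)$ with finite $S,Act,AP$, transition map $\eta:S\times Act\times S\to l$, $I:S\to l$, $L:S\to2^{AP}$; no terminal states means every $s$ has $\alpha,s'$ with $\eta(s,\alpha,s')>0$. For $\rho=s_0\alpha_1s_1\cdots$, $v(\rho)=I(s_0)\wedge\bigwedge_i\eta(s_i,\alpha_{i+1},s_{i+1})$; $\mathrm{Traces}(TS)(\sigma)=\bigvee\{v(\rho):L(s_0)L(s_1)\cdots=\sigma\}$; $TS\models P$ iff $\mathrm{Traces}(TS)(\sigma)\le P(\sigma)$ for all $\sigma$. A deterministic $l$-VBA $(Q,\Sigma,\delta,q_0,F)$ has finite $Q$, $\delta:Q\times\Sigma\to Q$, $q_0\in Q$, $F:Q\to l$; for $w=\sigma_1\sigma_2\cdots$ with run $q_{j}=\delta(q_{j-1},\sigma_j)$,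 $L_\omega(\mathcal A)(w)=\bigvee\{\bigwedge_{j\in J}F(q_j):J\subseteq\mathbb N\text{ infinite}\}$. The product $TS\otimes\mathcal A=(S\times Q,Act,\to',I',Q,L')$: $\eta'((s,q),\alpha,(t,p))=\eta(s,\alpha,t)$ if $\delta(q,L(t))=p$, else $0$; $I'(s,q)=I(s)$ if $\delta(q_0,L(s))=q$, else $0$; $L'(s,q)=\{q\}$. mv-proposition formulas over $AP'$: $\psi::=A\mid r\mid\psi\vee\psi\mid\psi\to\psi\mid\neg\psi$ ($r\in l$, $\wedge$ defined by de Morgan), $\psi(\Phi)$ evaluates atoms in $\Phi$ to $1$, others to $0$. $\mathrm{dpers}(\psi)(A_0A_1\cdots)=\bigwedge_{i\ge0}\bigvee_{j\ge i}\psi(A_j)$. *)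

theory Defs
  imports Main "HOL-Library.FuncSet"
begin

class complete_de_morgan_algebra = complete_lattice + distrib_lattice + uminus +
  assumes inf_Sup_distrib: "inf x (Sup A) = Sup (inf x ` A)"
    and neg_involutive: "- (- x) = x"
    and neg_antimono: "x \<le> y \<Longrightarrow> - y \<le> - x"

definition residual :: "'l \<Rightarrow> 'l \<Rightarrow> 'l::complete_de_morgan_algebra" where
  "residual a b = Sup {c. inf a c \<le> b}"

lemma residual_adjoint: "inf a c \<le> b \<longleftrightarrow> c \<le> residual a b"
proof
  assume "inf a c \<le> b"
  then show "c \<le> residual a b"
    unfolding residual_def by (auto intro: Sup_upper)
next
  assume "c \<le> residual a b"
  then have "inf a c \<le> inf a (Sup {c. inf a c \<le> b})"
    unfolding residual_def by (auto intro: le_infI2)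
  also have "\<dots> \<le> b"
    unfolding inf_Sup_distrib by (auto intro: Sup_least)
  finally show "inf a c \<le> b" .
qed

lemma neg_sup_neg: "- sup (- a) (- b) = inf a (b::'l::complete_de_morgan_algebra)"
proof (rule antisym)
  have "- sup (- a) (- b) \<le> - (- a)" "- sup (- a) (- b) \<le> - (- b)"
    by (auto intro: neg_antimono)
  then show "- sup (- a) (- b) \<le> inf a b"
    by (simp add: neg_involutive)
  have "sup (- a) (- b) \<le> - inf a b"
    by (auto intro: neg_antimono)
  then have "- (- inf a b) \<le> - sup (- a) (- b)"
    by (rule neg_antimono)
  then show "inf a b \<le> - sup (- a) (- b)"
    by (simp add: neg_involutive)
qed

text \<open>
  The carriers are explicit sets, so that any of them may be empty.  Only the values of
  \<open>trans\<close>, \<open>init\<close> and \<open>label\<close> on the carriers are relevant.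
\<close>

record ('s, 'act, 'ap, 'l) mvts =
  states :: "'s set"
  acts   :: "'act set"
  trans  :: "'s \<Rightarrow> 'act \<Rightarrow> 's \<Rightarrow> 'l"
  init   :: "'s \<Rightarrow> 'l"
  props  :: "'ap set"
  label  :: "'s \<Rightarrow> 'ap set"

definition mv_transition_system :: "('s, 'act, 'ap, 'l::complete_de_morgan_algebra) mvts \<Rightarrow> bool" where
  "mv_transition_system T \<longleftrightarrow>
     finite (states T) \<and> finite (acts T) \<and> finite (props T) \<and>
     label T \<in> states T \<rightarrow> Pow (props T)"

definition no_terminal_states :: "('s, 'act, 'ap, 'l::complete_de_morgan_algebra) mvts \<Rightarrow> bool" where
  "no_terminal_states T \<longleftrightarrow>
     (\<forall>s\<in>states T. \<exists>a\<in>acts T. \<exists>t\<in>states T. trans T s a t > bot)"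

text \<open>
  The sequence \<open>s\<^sub>0 \<alpha>\<^sub>1 s\<^sub>1 \<alpha>\<^sub>2 s\<^sub>2 \<dots>\<close> is represented by its states \<open>s\<close> and its
  actions \<open>a\<close>, where \<open>a i\<close> is the action \<open>\<alpha>\<^bsub>i+1\<^esub>\<close> leading from \<open>s i\<close> to \<open>s (Suc i)\<close>.
\<close>

definition path_value ::
  "('s, 'act, 'ap, 'l::complete_de_morgan_algebra) mvts \<Rightarrow> (nat \<Rightarrow> 's) \<Rightarrow> (nat \<Rightarrow> 'act) \<Rightarrow> 'l" where
  "path_value T s a = inf (init T (s 0)) (INF i. trans T (s i) (a i) (s (Suc i)))"

definition traces ::
  "('s, 'act, 'ap, 'l::complete_de_morgan_algebra) mvts \<Rightarrow> (nat \<Rightarrow> 'ap set) \<Rightarrow> 'l" where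
  "traces T \<sigma> = Sup {path_value T s a | s a.
     s \<in> UNIV \<rightarrow> states T \<and> a \<in> UNIV \<rightarrow> acts T \<and> (\<forall>i. label T (s i) = \<sigma> i)}"

definition satisfies ::
  "('s, 'act, 'ap, 'l::complete_de_morgan_algebra) mvts \<Rightarrow> ((nat \<Rightarrow> 'ap set) \<Rightarrow> 'l) \<Rightarrow> bool" where
  "satisfies T P \<longleftrightarrow> (\<forall>\<sigma> \<in> UNIV \<rightarrow> Pow (props T). traces T \<sigma> \<le> P \<sigma>)"

record ('q, 'a, 'l) vba =
  locs     :: "'q set"
  alphabet :: "'a set"
  delta    :: "'q \<Rightarrow> 'a \<Rightarrow> 'q"
  start    :: "'q"
  accept   :: "'q \<Rightarrow> 'l"

definition deterministic_vba :: "('q, 'a, 'l::complete_de_morgan_algebra) vba \<Rightarrow> bool" where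
  "deterministic_vba \<A> \<longleftrightarrow>
     finite (locs \<A>) \<and> start \<A> \<in> locs \<A> \<and>
     delta \<A> \<in> locs \<A> \<rightarrow> alphabet \<A> \<rightarrow> locs \<A>"

text \<open>The word \<open>\<sigma>\<^sub>1 \<sigma>\<^sub>2 \<dots>\<close> is indexed from 0, so \<open>w j\<close> is the letter \<open>\<sigma>\<^bsub>j+1\<^esub>\<close>.\<close>

primrec run :: "('q, 'a, 'l) vba \<Rightarrow> (nat \<Rightarrow> 'a) \<Rightarrow> nat \<Rightarrow> 'q" where
  "run \<A> w 0 = start \<A>"
| "run \<A> w (Suc j) = delta \<A> (run \<A> w j) (w j)"

definition omega_language ::
  "('q, 'a, 'l::complete_de_morgan_algebra) vba \<Rightarrow> (nat \<Rightarrow> 'a) \<Rightarrow> 'l" where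
  "omega_language \<A> w = Sup {(INF j\<in>J. accept \<A> (run \<A> w j)) | J. infinite J}"

definition product ::
  "('s, 'act, 'ap, 'l::complete_de_morgan_algebra) mvts \<Rightarrow> ('q, 'ap set, 'l) vba
    \<Rightarrow> ('s \<times> 'q, 'act, 'q, 'l) mvts" where
  "product T \<A> = \<lparr>
     states = states T \<times> locs \<A>,
     acts = acts T,
     trans = (\<lambda>(s, q) a (t, p). if delta \<A> q (label T t) = p then trans T s a t else bot),
     init = (\<lambda>(s, q). if delta \<A> (start \<A>) (label T s) = q then init T s else bot),
     props = locs \<A>,
     label = (\<lambda>(s, q). {q}) \<rparr>"

lemma mv_transition_system_product:
  assumes "mv_transition_system T" "deterministic_vba \<A>"
  shows "mv_transition_system (product T \<A>)"
  using assms by (auto simp: mv_transition_system_def deterministic_vba_def product_def)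

lemma no_terminal_states_product:
  assumes "mv_transition_system T" "no_terminal_states T"
    and "deterministic_vba \<A>" "alphabet \<A> = Pow (props T)"
  shows "no_terminal_states (product T \<A>)"
  unfolding no_terminal_states_def
proof
  fix x assume "x \<in> states (product T \<A>)"
  then obtain s q where x: "x = (s, q)" and s: "s \<in> states T" and q: "q \<in> locs \<A>"
    by (auto simp: product_def)
  from s assms(2) obtain a t where
    "a \<in> acts T" and t: "t \<in> states T" and "trans T s a t > bot"
    unfolding no_terminal_states_def by blast
  moreover have "delta \<A> q (label T t) \<in> locs \<A>"
    using assms q t by (auto simp: mv_transition_system_def deterministic_vba_def Pi_iff)
  ultimately show "\<exists>a\<in>acts (product T \<A>). \<exists>y\<in>states (product T \<A>). trans (product T \<A>) x a y > bot"
    unfolding x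
    by (intro bexI[of _ a] bexI[of _ "(t, delta \<A> q (label T t))"]) (auto simp: product_def)
qed

datatype ('ap, 'l) mvform =
    Atom 'ap
  | Const 'l
  | Or "('ap, 'l) mvform" "('ap, 'l) mvform"
  | Imp "('ap, 'l) mvform" "('ap, 'l) mvform"
  | Neg "('ap, 'l) mvform"

definition And :: "('ap, 'l) mvform \<Rightarrow> ('ap, 'l) mvform \<Rightarrow> ('ap, 'l) mvform" where
  "And \<psi> \<chi> = Neg (Or (Neg \<psi>) (Neg \<chi>))"

fun Disj :: "('ap, 'l::complete_de_morgan_algebra) mvform list \<Rightarrow> ('ap, 'l) mvform" where
  "Disj [] = Const bot"
| "Disj [\<psi>] = \<psi>"
| "Disj (\<psi> # \<chi> # \<psi>s) = Or \<psi> (Disj (\<chi> # \<psi>s))"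

primrec form_value :: "('ap, 'l::complete_de_morgan_algebra) mvform \<Rightarrow> 'ap set \<Rightarrow> 'l" where
  "form_value (Atom p) \<Phi> = (if p \<in> \<Phi> then top else bot)"
| "form_value (Const r) \<Phi> = r"
| "form_value (Or \<psi> \<chi>) \<Phi> = sup (form_value \<psi> \<Phi>) (form_value \<chi> \<Phi>)"
| "form_value (Imp \<psi> \<chi>) \<Phi> = residual (form_value \<psi> \<Phi>) (form_value \<chi> \<Phi>)"
| "form_value (Neg \<psi>) \<Phi> = - form_value \<psi> \<Phi>"

lemma form_value_And: "form_value (And \<psi> \<chi>) \<Phi> = inf (form_value \<psi> \<Phi>) (form_value \<chi> \<Phi>)"
  by (simp add: And_def neg_sup_neg)

lemma form_value_Disj: "form_value (Disj \<psi>s) \<Phi> = (SUP \<psi>\<in>set \<psi>s. form_value \<psi> \<Phi>)"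
  by (induction \<psi>s rule: Disj.induct) auto

definition dpers ::
  "('ap, 'l::complete_de_morgan_algebra) mvform \<Rightarrow> (nat \<Rightarrow> 'ap set) \<Rightarrow> 'l" where
  "dpers \<psi> A = (INF i. SUP j\<in>{i..}. form_value \<psi> (A j))"

text \<open>
  A formula denotes a finite disjunction only after an order of the disjuncts has been chosen;
  \<open>qs\<close> is a list enumerating the states of the automaton.
\<close>

definition accept_form ::
  "('q, 'a, 'l::complete_de_morgan_algebra) vba \<Rightarrow> 'q list \<Rightarrow> ('q, 'l) mvform" where
  "accept_form \<A> qs = Disj (map (\<lambda>q. And (Const (accept \<A> q)) (Atom q)) qs)"

end

theory Submission
  imports Defs "HOL-Library.Infinite_Set"
begin

text \<open>
  Since \<open>\<A>\<close> is deterministic, every path of the transition system lifts to exactly one path of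
  the product whose second component is the run of \<open>\<A>\<close>, and the lift has the same value; all
  other paths of the product have value \<open>bot\<close>.  Along a lifted path \<open>dpers\<close> is the limit superior
  of the acceptance values.  As there are finitely many automaton states, from some index on only
  states that recur infinitely often are visited, so this limit superior is a finite join of
  acceptance values of recurring states, hence the value of the word; no distributivity of
  meets over infinite joins is involved.
\<close>

lemma Sup_infinite_INF_eq_INF_SUP:
  fixes F :: "'q \<Rightarrow> 'l::complete_lattice" and f :: "nat \<Rightarrow> 'q"
  assumes fin: "finite (range f)"
  shows "Sup {(INF j\<in>J. F (f j)) | J. infinite J} = (INF i. SUP j\<in>{i..}. F (f j))"
proof (rule antisym)
  show "Sup {(INF j\<in>J. F (f j)) | J. infinite J} \<le> (INF i. SUP j\<in>{i..}. F (f j))"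
  proof (rule Sup_least, clarify, rule INF_greatest)
    \<comment> \<open>An infinite \<open>J\<close> meets every tail \<open>{i..}\<close>; any common
      index links the two sides.\<close>
    fix J :: "nat set" and i assume "infinite J"
    then obtain j where "j \<in> J" "i \<le> j"
      by (auto simp: infinite_nat_iff_unbounded_le)
    then have "(INF j\<in>J. F (f j)) \<le> F (f j)" "F (f j) \<le> (SUP j\<in>{i..}. F (f j))"
      by (auto intro: INF_lower SUP_upper)
    then show "(INF j\<in>J. F (f j)) \<le> (SUP j\<in>{i..}. F (f j))"
      by (rule order_trans)
  qed
next
  \<comment> \<open>\<open>R\<close> holds the transient values. Their fibres are finite and
    finitely many, so some \<open>n\<close> bounds all their indices; from \<open>n\<close> on every
    value recurs infinitely often.\<close>
  define R where "R = {q \<in> range f. finite (f -` {q})}"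
  have "finite (\<Union>q\<in>R. f -` {q})"
    using fin by (auto simp: R_def)
  then obtain n where n: "\<And>j. j \<in> (\<Union>q\<in>R. f -` {q}) \<Longrightarrow> j < n"
    by (auto simp: finite_nat_set_iff_bounded)
  have "F (f j) \<le> Sup {(INF j\<in>J. F (f j)) | J. infinite J}" if "n \<le> j" for j
  proof (rule Sup_upper, intro CollectI exI conjI)
    \<comment> \<open>The witness for \<open>J\<close> is the fibre of \<open>f j\<close>:
      \<open>F\<close> is constant along it, so the infimum is \<open>F (f j)\<close>
      itself.\<close>
    show "infinite (f -` {f j})"
      using n[of j] that by (auto simp: R_def)
    show "F (f j) = (INF i\<in>f -` {f j}. F (f i))"
      by (rule antisym) (auto intro: INF_greatest INF_lower2)
  qed
  then have "(SUP j\<in>{n..}. F (f j)) \<le> Sup {(INF j\<in>J. F (f j)) | J. infinite J}"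
    by (auto intro: SUP_least)
  then show "(INF i. SUP j\<in>{i..}. F (f j)) \<le> Sup {(INF j\<in>J. F (f j)) | J. infinite J}"
    by (rule INF_lower2[OF UNIV_I])
qed

text \<open>A limit superior ignores the first term. This absorbs an index shift: the word value
  counts the run from \<open>start\<close>, while a product path begins after one letter has been
  read.\<close>

lemma INF_SUP_Suc:
  fixes g :: "nat \<Rightarrow> 'l::complete_lattice"
  shows "(INF i. SUP j\<in>{i..}. g (Suc j)) = (INF i. SUP j\<in>{i..}. g j)"
proof -
  have "Suc ` {i..} = {Suc i..}" for i
    by (auto simp: image_iff dest: Suc_le_D)
  then have shift: "(SUP j\<in>{i..}. g (Suc j)) = (SUP j\<in>{Suc i..}. g j)" for i
    by (metis image_image)
  have "(INF i. SUP j\<in>{Suc i..}. g j) = (INF i. SUP j\<in>{i..}. g j)"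
  proof (rule antisym)
    show "(INF i. SUP j\<in>{Suc i..}. g j) \<le> (INF i. SUP j\<in>{i..}. g j)"
      by (rule INF_mono') (auto intro: SUP_subset_mono)
    show "(INF i. SUP j\<in>{i..}. g j) \<le> (INF i. SUP j\<in>{Suc i..}. g j)"
      by (rule INF_greatest) (rule INF_lower, simp)
  qed
  then show ?thesis
    by (simp add: shift)
qed

lemma run_in_locs:
  assumes "deterministic_vba \<A>" "w \<in> UNIV \<rightarrow> alphabet \<A>"
  shows "run \<A> w j \<in> locs \<A>"
  using assms by (induction j) (auto simp: deterministic_vba_def Pi_iff)

text \<open>Under the label \<open>{q}\<close> only the atom \<open>q\<close> is \<open>top\<close>,
  so all disjuncts for other states collapse to \<open>bot\<close>.\<close>

lemma form_value_accept_form: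
  assumes "q \<in> set qs"
  shows "form_value (accept_form \<A> qs) {q} = accept \<A> q"
  unfolding accept_form_def form_value_Disj set_map image_image form_value_And
  using assms by (intro antisym SUP_least) (auto intro: SUP_upper2)

lemma dpers_accept_form_run:
  assumes det: "deterministic_vba \<A>" and w: "w \<in> UNIV \<rightarrow> alphabet \<A>" and qs: "set qs = locs \<A>"
  shows "dpers (accept_form \<A> qs) (\<lambda>i. {run \<A> w (Suc i)}) = omega_language \<A> w"
proof -
  have "finite (range (run \<A> w))"
    using run_in_locs[OF det w] det
    by (auto simp: deterministic_vba_def intro: finite_subset[of _ "locs \<A>"])
  then have "omega_language \<A> w = (INF i. SUP j\<in>{i..}. accept \<A> (run \<A> w j))"
    unfolding omega_language_def by (rule Sup_infinite_INF_eq_INF_SUP)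
  also have "\<dots> = (INF i. SUP j\<in>{i..}. accept \<A> (run \<A> w (Suc j)))"
    by (rule INF_SUP_Suc[symmetric])
  also have "\<dots> = dpers (accept_form \<A> qs) (\<lambda>i. {run \<A> w (Suc i)})"
    unfolding dpers_def
    by (simp only: form_value_accept_form run_in_locs[OF det w] qs)
  finally show ?thesis ..
qed

text \<open>The recursion of \<open>run\<close> is exactly the condition tested in
  \<open>init\<close> and \<open>trans\<close> of the product, so no \<open>bot\<close> branch is
  taken.\<close>

lemma path_value_product_run:
  "path_value (product T \<A>) (\<lambda>i. (s i, run \<A> (\<lambda>i. label T (s i)) (Suc i))) a = path_value T s a"
  by (simp add: path_value_def product_def)

text \<open>A single \<open>bot\<close> factor would make the whole meet \<open>bot\<close>. Hence
  each test in the product succeeds and determines the next automaton state.\<close>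

lemma path_value_product_neq_bot:
  assumes "path_value (product T \<A>) x a \<noteq> bot"
  shows "x i = (fst (x i), run \<A> (\<lambda>i. label T (fst (x i))) (Suc i))"
proof -
  have "init (product T \<A>) (x 0) \<noteq> bot"
    using assms by (auto simp: path_value_def)
  then have init: "snd (x 0) = delta \<A> (start \<A>) (label T (fst (x 0)))"
    by (auto simp: product_def split: prod.splits if_splits)
  have step: "snd (x (Suc i)) = delta \<A> (snd (x i)) (label T (fst (x (Suc i))))" for i
  proof -
    have "path_value (product T \<A>) x a \<le> trans (product T \<A>) (x i) (a i) (x (Suc i))"
      unfolding path_value_def by (intro le_infI2 INF_lower UNIV_I)
    then have "trans (product T \<A>) (x i) (a i) (x (Suc i)) \<noteq> bot"
      using assms by (auto simp: bot_unique)
    then show ?thesis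
      by (auto simp: product_def split: prod.splits if_splits)
  qed
  have "snd (x i) = run \<A> (\<lambda>i. label T (fst (x i))) (Suc i)"
    by (induction i) (simp_all add: init step)
  then show ?thesis
    by (simp add: prod_eq_iff)
qed

text \<open>A supremum is below a bound iff each member is, which removes \<open>traces\<close> in
  favour of single paths. The hypothesis makes the label word of a path one of the words over which
  \<open>satisfies\<close> quantifies.\<close>

lemma satisfies_iff_path_value:
  fixes T :: "('s, 'act, 'ap, 'l::complete_de_morgan_algebra) mvts"
  assumes "label T \<in> states T \<rightarrow> Pow (props T)"
  shows "satisfies T P \<longleftrightarrow>
    (\<forall>s \<in> UNIV \<rightarrow> states T. \<forall>a \<in> UNIV \<rightarrow> acts T. path_value T s a \<le> P (\<lambda>i. label T (s i)))"
    (is "_ \<longleftrightarrow> ?paths")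
proof
  assume sat: "satisfies T P"
  show ?paths
  proof (intro ballI)
    fix s :: "nat \<Rightarrow> 's" and a :: "nat \<Rightarrow> 'act"
    assume s: "s \<in> UNIV \<rightarrow> states T" and a: "a \<in> UNIV \<rightarrow> acts T"
    have "path_value T s a \<le> traces T (\<lambda>i. label T (s i))"
      unfolding traces_def using s a by (auto intro: Sup_upper)
    also have "\<dots> \<le> P (\<lambda>i. label T (s i))"
      using sat s assms by (auto simp: satisfies_def Pi_iff)
    finally show "path_value T s a \<le> P (\<lambda>i. label T (s i))" .
  qed
next
  assume paths: ?paths
  show "satisfies T P"
    unfolding satisfies_def traces_def
  proof (intro ballI Sup_least, clarify)
    fix \<sigma> and s :: "nat \<Rightarrow> 's" and a :: "nat \<Rightarrow> 'act"
    assume "s \<in> UNIV \<rightarrow> states T" "a \<in> UNIV \<rightarrow> acts T" "\<forall>i. label T (s i) = \<sigma> i"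
    moreover from this(3) have "(\<lambda>i. label T (s i)) = \<sigma>"
      by auto
    ultimately show "path_value T s a \<le> P \<sigma>"
      using paths by blast
  qed
qed

theorem theorem4:
  fixes TS :: "('s, 'act, 'ap, 'l::complete_de_morgan_algebra) mvts"
    and \<A> :: "('q, 'ap set, 'l) vba"
    and P :: "(nat \<Rightarrow> 'ap set) \<Rightarrow> 'l"
    and qs :: "'q list"
  assumes "mv_transition_system TS"
    and "no_terminal_states TS"
    and "deterministic_vba \<A>"
    and "alphabet \<A> = Pow (props TS)"
    and "\<And>w. w \<in> UNIV \<rightarrow> Pow (props TS) \<Longrightarrow> omega_language \<A> w = P w"
    and "distinct qs" and "set qs = locs \<A>"
  shows "satisfies TS P \<longleftrightarrow> satisfies (product TS \<A>) (dpers (accept_form \<A> qs))"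
proof -
  have lab: "label TS \<in> states TS \<rightarrow> Pow (props TS)"
    using assms(1) by (simp add: mv_transition_system_def)
  have lab_prod: "label (product TS \<A>) \<in> states (product TS \<A>) \<rightarrow> Pow (props (product TS \<A>))"
    using mv_transition_system_product[OF assms(1,3)] by (simp add: mv_transition_system_def)
  \<comment> \<open>The index is \<open>Suc i\<close> because the product state at position
    \<open>i\<close> has already read the labels of \<open>s 0\<close> up to
    \<open>s i\<close>.\<close>
  define lift where "lift s = (\<lambda>i. (s i, run \<A> (\<lambda>i. label TS (s i)) (Suc i)))" for s
  have word: "(\<lambda>i. label TS (s i)) \<in> UNIV \<rightarrow> alphabet \<A>" if "s \<in> UNIV \<rightarrow> states TS" for s
    using that lab assms(4) by auto
  have lift_states: "lift s \<in> UNIV \<rightarrow> states (product TS \<A>)" if s: "s \<in> UNIV \<rightarrow> states TS" for s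
    using s run_in_locs[OF assms(3) word[OF s]]
    by (auto simp: lift_def product_def simp del: run.simps)
  have lift_value: "path_value (product TS \<A>) (lift s) a = path_value TS s a" for s a
    unfolding lift_def by (rule path_value_product_run)
  have lift_dpers: "dpers (accept_form \<A> qs) (\<lambda>i. label (product TS \<A>) (lift s i)) =
      P (\<lambda>i. label TS (s i))" if s: "s \<in> UNIV \<rightarrow> states TS" for s
    using dpers_accept_form_run[OF assms(3) word[OF s] assms(7)] assms(5) word[OF s] assms(4)
    by (simp add: lift_def product_def del: run.simps)
  have acts_prod: "acts (product TS \<A>) = acts TS"
    by (simp add: product_def)
  show ?thesis
    unfolding satisfies_iff_path_value[OF lab] satisfies_iff_path_value[OF lab_prod] acts_prod
  proof (intro iffI ballI)
    fix x :: "nat \<Rightarrow> 's \<times> 'q" and a :: "nat \<Rightarrow> 'act"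
    assume paths: "\<forall>s \<in> UNIV \<rightarrow> states TS. \<forall>a \<in> UNIV \<rightarrow> acts TS.
        path_value TS s a \<le> P (\<lambda>i. label TS (s i))"
      and x: "x \<in> UNIV \<rightarrow> states (product TS \<A>)" and a: "a \<in> UNIV \<rightarrow> acts TS"
    show "path_value (product TS \<A>) x a \<le>
        dpers (accept_form \<A> qs) (\<lambda>i. label (product TS \<A>) (x i))"
    \<comment> \<open>Paths of value \<open>bot\<close> meet any bound; every other path is the lift
      of its first projection.\<close>
    proof (cases "path_value (product TS \<A>) x a = bot")
      case False
      define s where "s = fst \<circ> x"
      have "x = lift s"
        using path_value_product_neq_bot[OF False]
        by (auto simp: lift_def s_def simp del: run.simps)
      moreover have "s \<in> UNIV \<rightarrow> states TS"
        using x by (auto simp: s_def product_def Pi_iff mem_Times_iff)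
      ultimately show ?thesis
        using paths a by (simp add: lift_value lift_dpers)
    qed simp
  next
    fix s :: "nat \<Rightarrow> 's" and a :: "nat \<Rightarrow> 'act"
    assume "\<forall>x \<in> UNIV \<rightarrow> states (product TS \<A>). \<forall>a \<in> UNIV \<rightarrow> acts TS.
        path_value (product TS \<A>) x a \<le>
          dpers (accept_form \<A> qs) (\<lambda>i. label (product TS \<A>) (x i))"
      and s: "s \<in> UNIV \<rightarrow> states TS" and a: "a \<in> UNIV \<rightarrow> acts TS"
    \<comment> \<open>For the converse it suffices to test the product on lifts, which preserve the
      value and turn \<open>dpers\<close> into \<open>P\<close>.\<close>
    then have "path_value (product TS \<A>) (lift s) a \<le>
        dpers (accept_form \<A> qs) (\<lambda>i. label (product TS \<A>) (lift s i))"
      using lift_states by blast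
    then show "path_value TS s a \<le> P (\<lambda>i. label TS (s i))"
      by (simp add: lift_value lift_dpers[OF s])
  qed
qed

end
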